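(* Let $F=F(X)$ be a free group with finite free basis $X$ and let $\mu$ be a probability distribution on $F$ whose weight function $M$ is totally defined. Then $|\mathbb{E}(\mu)|\le2$.
   Context: $d$ is the word metric on $F$ with respect to $X$, i.e. the graph distance in the Cayley graph of $F$ with respect to $X$. The weight function of $\mu$ is $M(h)=\sum_{s\in F}d^2(h,s)\mu(s)$, totally defined if finite for all $h\in F$. The mean-set is $\mathbb{E}(\mu)=\{h\in F\mid M(h)\le M(f)\ \forall f\in F\}$. *)

theory Defs
  imports "HOL-Algebra.Group" "HOL-Probability.Probability_Mass_Function"
begin

text \<open>
  A word over \<open>X\<close> and its formal inverses is a list of letters \<open>(x, b)\<close> with \<open>x \<in> X\<close>, where
  \<open>(x, True)\<close> stands for \<open>x\<close> and \<open>(x, False)\<close> for the inverse of \<open>x\<close>.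
\<close>

definition letter_val :: "('a, 'm) monoid_scheme \<Rightarrow> 'a \<times> bool \<Rightarrow> 'a" where
  "letter_val F p = (if snd p then fst p else inv\<^bsub>F\<^esub> (fst p))"

definition word_val :: "('a, 'm) monoid_scheme \<Rightarrow> ('a \<times> bool) list \<Rightarrow> 'a" where
  "word_val F w = foldr (\<lambda>p g. letter_val F p \<otimes>\<^bsub>F\<^esub> g) w \<one>\<^bsub>F\<^esub>"

definition reduced_word :: "('a \<times> bool) list \<Rightarrow> bool" where
  "reduced_word w \<longleftrightarrow> successively (\<lambda>p q. \<not> (fst p = fst q \<and> snd p \<noteq> snd q)) w"

definition free_basis :: "('a, 'm) monoid_scheme \<Rightarrow> 'a set \<Rightarrow> bool" where
  "free_basis F X \<longleftrightarrow> X \<subseteq> carrier F \<and>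
     (\<forall>g \<in> carrier F. \<exists>!w. w \<in> lists (X \<times> UNIV) \<and> reduced_word w \<and> word_val F w = g)"

text \<open>Adjacency in the undirected Cayley graph, whose edges join \<open>g\<close> and \<open>g x\<close> for \<open>x \<in> X\<close>.\<close>

definition cayley_adj :: "('a, 'm) monoid_scheme \<Rightarrow> 'a set \<Rightarrow> ('a \<times> 'a) set" where
  "cayley_adj F X = {(g, h). g \<in> carrier F \<and> h \<in> carrier F \<and>
     (\<exists>x \<in> X. h = g \<otimes>\<^bsub>F\<^esub> x \<or> g = h \<otimes>\<^bsub>F\<^esub> x)}"

text \<open>
  The graph distance is the least length of a walk from \<open>g\<close> to \<open>h\<close>; it is only meaningful if
  such a walk exists, which is the case for all \<open>g\<close>, \<open>h\<close> when \<open>X\<close> generates \<open>F\<close>.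
\<close>

definition word_dist :: "('a, 'm) monoid_scheme \<Rightarrow> 'a set \<Rightarrow> 'a \<Rightarrow> 'a \<Rightarrow> nat" where
  "word_dist F X g h = (LEAST n. (g, h) \<in> cayley_adj F X ^^ n)"

text \<open>
  \<open>infsum\<close> is 0 on families that are not summable, so \<open>weight\<close> and \<open>mean_set\<close> have their
  intended meaning under \<open>weight_totally_defined\<close>. The terms are nonnegative, so
  summability is the same as finiteness of the sum.
\<close>

definition weight :: "('a, 'm) monoid_scheme \<Rightarrow> 'a set \<Rightarrow> 'a pmf \<Rightarrow> 'a \<Rightarrow> real" where
  "weight F X \<mu> h = (\<Sum>\<^sub>\<infinity>s\<in>carrier F. (real (word_dist F X h s))\<^sup>2 * pmf \<mu> s)"

definition weight_totally_defined :: "('a, 'm) monoid_scheme \<Rightarrow> 'a set \<Rightarrow> 'a pmf \<Rightarrow> bool" where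
  "weight_totally_defined F X \<mu> \<longleftrightarrow>
     (\<forall>h \<in> carrier F. (\<lambda>s. (real (word_dist F X h s))\<^sup>2 * pmf \<mu> s) summable_on carrier F)"

definition mean_set :: "('a, 'm) monoid_scheme \<Rightarrow> 'a set \<Rightarrow> 'a pmf \<Rightarrow> 'a set" where
  "mean_set F X \<mu> =
     {h \<in> carrier F. \<forall>f \<in> carrier F. weight F X \<mu> h \<le> weight F X \<mu> f}"

end

theory Submission
  imports Defs
begin

text \<open>
  The Cayley graph of a free group with respect to a basis is a tree, and on a tree the weight
  function is strictly convex along geodesics. The local form of this convexity carries the proof.
  Moving from a vertex \<open>p\<close> along an edge changes the distance to a given point \<open>s\<close> by exactly 1,
  and at most one of the edges at \<open>p\<close> leads towards \<open>s\<close>, namely the one labelled by the first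
  letter of the normal form of \<open>p\<inverse>s\<close>. So if \<open>q\<close> and \<open>r\<close> are different neighbours of \<open>p\<close> and
  \<open>d = d(p,s)\<close>, then \<open>d(q,s)\<^sup>2 + d(r,s)\<^sup>2\<close> is at least
  \<open>(d-1)\<^sup>2 + (d+1)\<^sup>2 = 2d\<^sup>2 + 2\<close>. Averaging over \<open>s\<close> gives \<open>M(q) + M(r) \<ge> 2M(p) + 2\<close>
  (\<open>weight_midpoint\<close>).

  Consequently, along a path without backtracking that starts at a minimum of \<open>M\<close>, each increment
  of \<open>M\<close> exceeds the previous one by at least 2. The first increment is nonnegative, so \<open>M\<close>
  is strictly larger at every vertex of the path from the second step on. Hence
  any two different minima are adjacent (\<open>mean_set_adjacent\<close>). If there were three minima, two of
  them would be different neighbours of the third, and the midpoint inequality would force one of the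
  three values of \<open>M\<close> to be above another (\<open>mean_set_no_three\<close>).
\<close>

section \<open>Normal forms and the word metric\<close>

locale free_group = group F for F (structure) +
  fixes X :: "'a set"
  assumes basis: "free_basis F X"
begin

abbreviation letters :: "('a \<times> bool) set" where
  "letters \<equiv> X \<times> UNIV"

definition inv_letter :: "'a \<times> bool \<Rightarrow> 'a \<times> bool" where
  "inv_letter a = (fst a, \<not> snd a)"

definition normal_form :: "'a \<Rightarrow> ('a \<times> bool) list" where
  "normal_form g = (THE w. w \<in> lists letters \<and> reduced_word w \<and> word_val F w = g)"

lemma basis_closed: "x \<in> X \<Longrightarrow> x \<in> carrier F"
  using basis unfolding free_basis_def by blast

lemma inv_letter_in [simp]: "inv_letter a \<in> letters \<longleftrightarrow> a \<in> letters"
  by (cases a) (auto simp: inv_letter_def)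

lemma inv_letter_inv_letter [simp]: "inv_letter (inv_letter a) = a"
  by (simp add: inv_letter_def)

lemma letter_val_closed [simp]: "a \<in> letters \<Longrightarrow> letter_val F a \<in> carrier F"
  by (auto simp: letter_val_def basis_closed)

lemma letter_val_inv_letter: "a \<in> letters \<Longrightarrow> letter_val F (inv_letter a) = inv (letter_val F a)"
  by (auto simp: letter_val_def basis_closed inv_letter_def)

lemma word_val_Nil [simp]: "word_val F [] = \<one>"
  by (simp add: word_val_def)

lemma word_val_Cons [simp]: "word_val F (a # w) = letter_val F a \<otimes> word_val F w"
  by (simp add: word_val_def)

lemma word_val_closed [simp]: "w \<in> lists letters \<Longrightarrow> word_val F w \<in> carrier F"
  by (induction w) (simp_all del: mem_Sigma_iff)

text \<open>
  Phrased by the shape of the tail instead of by its head, so that it matches the case distinction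
  on whether a letter cancels.
\<close>

lemma reduced_word_Cons:
  "reduced_word (a # w) \<longleftrightarrow> reduced_word w \<and> (\<forall>w'. w \<noteq> inv_letter a # w')"
proof (cases w)
  case (Cons b v)
  have "\<not> (fst a = fst b \<and> snd a \<noteq> snd b) \<longleftrightarrow> b \<noteq> inv_letter a"
    by (cases a; cases b) (auto simp: inv_letter_def)
  then show ?thesis by (simp add: Cons reduced_word_def conj_commute)
qed (simp add: reduced_word_def)

lemma normal_form:
  assumes "g \<in> carrier F"
  shows "normal_form g \<in> lists letters" "reduced_word (normal_form g)"
    "word_val F (normal_form g) = g"
proof -
  have "\<exists>!w. w \<in> lists letters \<and> reduced_word w \<and> word_val F w = g"
    using basis assms unfolding free_basis_def by blast
  from theI'[OF this] show "normal_form g \<in> lists letters" "reduced_word (normal_form g)"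
    "word_val F (normal_form g) = g"
    unfolding normal_form_def by blast+
qed

lemma normal_form_eqI:
  assumes "w \<in> lists letters" "reduced_word w"
  shows "normal_form (word_val F w) = w"
proof -
  have "\<exists>!v. v \<in> lists letters \<and> reduced_word v \<and> word_val F v = word_val F w"
    using basis word_val_closed[OF assms(1)] unfolding free_basis_def by blast
  with assms show ?thesis
    unfolding normal_form_def by (intro the1_equality) auto
qed

text \<open>
  Multiplying by a letter on the left cancels the first letter of the normal form or prepends a
  new one: both resulting words are already reduced, and the normal form is unique. This is where
  the tree structure of the Cayley graph comes from.
\<close>

lemma normal_form_letter_mult:
  assumes a: "a \<in> letters" and g: "g \<in> carrier F"
  shows "(\<exists>w. normal_form g = inv_letter a # w \<and> normal_form (letter_val F a \<otimes> g) = w) \<or>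
    ((\<forall>w. normal_form g \<noteq> inv_letter a # w) \<and>
      normal_form (letter_val F a \<otimes> g) = a # normal_form g)"
proof (cases "\<exists>w. normal_form g = inv_letter a # w")
  case True
  then obtain w where w: "normal_form g = inv_letter a # w" by blast
  have wl: "w \<in> lists letters" and wr: "reduced_word w"
    using normal_form(1,2)[OF g] by (auto simp: w reduced_word_Cons)
  have "g = inv (letter_val F a) \<otimes> word_val F w"
    using normal_form(3)[OF g] letter_val_inv_letter[OF a] by (simp add: w)
  then have "letter_val F a \<otimes> g = word_val F w"
    using a wl by (simp add: m_assoc[symmetric] del: mem_Sigma_iff)
  with normal_form_eqI[OF wl wr] w show ?thesis by simp
next
  case False
  then have "reduced_word (a # normal_form g)"
    using normal_form(2)[OF g] by (simp add: reduced_word_Cons)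
  moreover have "a # normal_form g \<in> lists letters"
    using a normal_form(1)[OF g] by simp
  ultimately have "normal_form (word_val F (a # normal_form g)) = a # normal_form g"
    by (intro normal_form_eqI)
  with False show ?thesis using normal_form(3)[OF g] by simp
qed

lemma cayley_adj_iff:
  assumes "g \<in> carrier F"
  shows "(g, h) \<in> cayley_adj F X \<longleftrightarrow> (\<exists>a\<in>letters. h = g \<otimes> letter_val F a)"
proof
  assume "(g, h) \<in> cayley_adj F X"
  then obtain x where x: "x \<in> X" "h \<in> carrier F" and eq: "h = g \<otimes> x \<or> g = h \<otimes> x"
    by (auto simp: cayley_adj_def)
  have "x \<in> carrier F" using x by (simp add: basis_closed)
  with x eq assms have "h = g \<otimes> letter_val F (x, True) \<or> h = g \<otimes> letter_val F (x, False)"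
    by (auto simp: letter_val_def inv_solve_right)
  with x show "\<exists>a\<in>letters. h = g \<otimes> letter_val F a" by blast
next
  assume "\<exists>a\<in>letters. h = g \<otimes> letter_val F a"
  then obtain x b where x: "x \<in> X" and h: "h = g \<otimes> letter_val F (x, b)" by auto
  have "x \<in> carrier F" using x by (simp add: basis_closed)
  with x h assms show "(g, h) \<in> cayley_adj F X"
    by (cases b) (auto simp: cayley_adj_def letter_val_def m_assoc intro!: bexI[of _ x])
qed

lemma word_path:
  assumes "w \<in> lists letters" "g \<in> carrier F"
  shows "(g, g \<otimes> word_val F w) \<in> cayley_adj F X ^^ length w"
  using assms
proof (induction w arbitrary: g)
  case (Cons a w)
  then have a: "a \<in> letters" and w: "w \<in> lists letters" by auto
  let ?h = "g \<otimes> letter_val F a"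
  have "(g, ?h) \<in> cayley_adj F X"
    using a Cons.prems by (auto simp: cayley_adj_iff simp del: mem_Sigma_iff)
  moreover have "(?h, ?h \<otimes> word_val F w) \<in> cayley_adj F X ^^ length w"
    using a w Cons.prems by (intro Cons.IH) auto
  ultimately have "(g, ?h \<otimes> word_val F w) \<in> cayley_adj F X ^^ Suc (length w)"
    by (rule relpow_Suc_I2)
  then show ?case using a w Cons.prems by (simp add: m_assoc)
qed simp

text \<open>
  Each step of a walk from \<open>g\<close> to \<open>h\<close> multiplies \<open>g\<inverse>h\<close> by a letter on the left, which changes the
  length of its normal form by at most 1. Together with the walk spelled by the
  normal form itself this identifies the distance.
\<close>

lemma length_normal_form_le:
  assumes "(g, h) \<in> cayley_adj F X ^^ n" "g \<in> carrier F" "h \<in> carrier F"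
  shows "length (normal_form (inv g \<otimes> h)) \<le> n"
  using assms
proof (induction n arbitrary: g)
  case 0
  then have "normal_form (inv g \<otimes> h) = []"
    using normal_form_eqI[of "[]"] by (simp add: reduced_word_def)
  then show ?case by simp
next
  case (Suc n)
  obtain k where gk: "(g, k) \<in> cayley_adj F X" and kh: "(k, h) \<in> cayley_adj F X ^^ n"
    using relpow_Suc_E2[OF Suc.prems(1)] by blast
  obtain a where a: "a \<in> letters" and k: "k = g \<otimes> letter_val F a"
    using gk Suc.prems(2) by (auto simp: cayley_adj_iff simp del: mem_Sigma_iff)
  have kc: "k \<in> carrier F" using a k Suc.prems by simp
  have "inv g \<otimes> h = letter_val F a \<otimes> (inv k \<otimes> h)"
    using a Suc.prems by (simp add: k inv_mult_group m_assoc[symmetric])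
  moreover have "length (normal_form (letter_val F a \<otimes> (inv k \<otimes> h)))
      \<le> Suc (length (normal_form (inv k \<otimes> h)))"
    using normal_form_letter_mult[OF a, of "inv k \<otimes> h"] kc Suc.prems by auto
  moreover have "length (normal_form (inv k \<otimes> h)) \<le> n"
    using Suc.IH[OF kh kc] Suc.prems by simp
  ultimately show ?case by simp
qed

lemma word_dist_eq_length:
  assumes "g \<in> carrier F" "h \<in> carrier F"
  shows "word_dist F X g h = length (normal_form (inv g \<otimes> h))"
  unfolding word_dist_def
proof (rule Least_equality)
  have "inv g \<otimes> h \<in> carrier F" using assms by simp
  from word_path[OF normal_form(1)[OF this] assms(1)] normal_form(3)[OF this] assms
  show "(g, h) \<in> cayley_adj F X ^^ length (normal_form (inv g \<otimes> h))"
    by (simp add: m_assoc[symmetric])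
qed (rule length_normal_form_le[OF _ assms])

text \<open>
  The neighbour of \<open>p\<close> in direction \<open>a\<close> is nearer to \<open>s\<close> exactly if the normal form of \<open>p\<inverse>s\<close>
  begins with \<open>a\<close>. Since a word has only one first letter, all other neighbours are farther away.
\<close>

lemma word_dist_neighbour:
  assumes "p \<in> carrier F" "s \<in> carrier F" "a \<in> letters"
  shows "if \<exists>w. normal_form (inv p \<otimes> s) = a # w
    then word_dist F X p s = Suc (word_dist F X (p \<otimes> letter_val F a) s)
    else word_dist F X (p \<otimes> letter_val F a) s = Suc (word_dist F X p s)"
proof -
  have "inv (p \<otimes> letter_val F a) \<otimes> s = letter_val F (inv_letter a) \<otimes> (inv p \<otimes> s)"
    using assms by (simp add: inv_mult_group letter_val_inv_letter m_assoc)
  then show ?thesis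
    using normal_form_letter_mult[of "inv_letter a" "inv p \<otimes> s"] assms
    by (auto simp: word_dist_eq_length simp del: mem_Sigma_iff)
qed

text \<open>
  At most one of the two distances drops to \<open>d - 1\<close> and the rest are \<open>d + 1\<close>. If one drops there
  is equality, and if none does the right-hand side is \<open>2(d + 1)\<^sup>2\<close>.
\<close>

lemma word_dist_sq_midpoint:
  assumes "p \<in> carrier F" "s \<in> carrier F" "a \<in> letters" "b \<in> letters" "a \<noteq> b"
  shows "2 * (real (word_dist F X p s))\<^sup>2 + 2 \<le>
    (real (word_dist F X (p \<otimes> letter_val F a) s))\<^sup>2 + (real (word_dist F X (p \<otimes> letter_val F b) s))\<^sup>2"
proof -
  define d where "d q = real (word_dist F X q s)" for q
  have "\<not> ((\<exists>w. normal_form (inv p \<otimes> s) = a # w) \<and> (\<exists>w. normal_form (inv p \<otimes> s) = b # w))"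
    using assms(5) by auto
  moreover have "d (p \<otimes> letter_val F c) = d p + 1 \<or>
      (\<exists>w. normal_form (inv p \<otimes> s) = c # w) \<and> d (p \<otimes> letter_val F c) = d p - 1"
    if "c \<in> letters" for c
    using word_dist_neighbour[OF assms(1,2) that] by (auto simp: d_def split: if_splits)
  ultimately consider
      "d (p \<otimes> letter_val F a) = d p + 1" "d (p \<otimes> letter_val F b) = d p + 1"
    | "d (p \<otimes> letter_val F a) = d p + 1" "d (p \<otimes> letter_val F b) = d p - 1"
    | "d (p \<otimes> letter_val F a) = d p - 1" "d (p \<otimes> letter_val F b) = d p + 1"
    using assms(3,4) by meson
  moreover have "0 \<le> d p" by (simp add: d_def)
  ultimately have "2 * (d p)\<^sup>2 + 2 \<le> (d (p \<otimes> letter_val F a))\<^sup>2 + (d (p \<otimes> letter_val F b))\<^sup>2"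
    by cases (simp_all only: power2_sum power2_diff, simp_all)
  then show ?thesis by (simp add: d_def)
qed

end

lemma has_sum_pmf:
  assumes "set_pmf \<mu> \<subseteq> A"
  shows "(pmf \<mu> has_sum 1) A"
proof -
  have "infsum (pmf \<mu>) A = infsetsum (pmf \<mu>) A"
    using infsetsum_infsum[OF pmf_abs_summable[of \<mu> A]] by simp
  also have "\<dots> = 1" using assms by (rule infsetsum_pmf_eq_1)
  finally have "infsum (pmf \<mu>) A = 1" .
  moreover have "pmf \<mu> summable_on A"
    by (rule abs_summable_summable) (use abs_summable_equivalent pmf_abs_summable in blast)
  ultimately show ?thesis using has_sum_infsum[of "pmf \<mu>" A] by simp
qed

section \<open>Convexity of the weight function\<close>

locale weighted_free_group = free_group +
  fixes \<mu> :: "'a pmf"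
  assumes supp: "set_pmf \<mu> \<subseteq> carrier F"
    and total: "weight_totally_defined F X \<mu>"
begin

text \<open>
  The expectation of the pointwise inequality \<open>word_dist_sq_midpoint\<close>. The constant 2 survives
  because \<open>\<mu>\<close> has total mass 1 on the carrier, and it is what makes the convexity strict.
\<close>

lemma weight_midpoint:
  assumes "p \<in> carrier F" "a \<in> letters" "b \<in> letters" "a \<noteq> b"
  shows "2 * weight F X \<mu> p + 2 \<le>
    weight F X \<mu> (p \<otimes> letter_val F a) + weight F X \<mu> (p \<otimes> letter_val F b)"
proof -
  let ?d2 = "\<lambda>q s. (real (word_dist F X q s))\<^sup>2"
  have M: "((\<lambda>s. ?d2 q s * pmf \<mu> s) has_sum weight F X \<mu> q) (carrier F)" if "q \<in> carrier F" for q
    using total that by (simp add: weight_totally_defined_def weight_def)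
  have lower: "((\<lambda>s. 2 * (?d2 p s * pmf \<mu> s) + 2 * pmf \<mu> s) has_sum (2 * weight F X \<mu> p + 2 * 1)) (carrier F)"
    using assms by (intro has_sum_add has_sum_cmult_right M has_sum_pmf supp)
  have upper: "((\<lambda>s. ?d2 (p \<otimes> letter_val F a) s * pmf \<mu> s + ?d2 (p \<otimes> letter_val F b) s * pmf \<mu> s)
      has_sum (weight F X \<mu> (p \<otimes> letter_val F a) + weight F X \<mu> (p \<otimes> letter_val F b))) (carrier F)"
    using assms by (intro has_sum_add M) auto
  have "2 * (?d2 p s * pmf \<mu> s) + 2 * pmf \<mu> s \<le>
      ?d2 (p \<otimes> letter_val F a) s * pmf \<mu> s + ?d2 (p \<otimes> letter_val F b) s * pmf \<mu> s"
    if "s \<in> carrier F" for s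
    using mult_right_mono[OF word_dist_sq_midpoint[OF assms(1) that assms(2-4)], of "pmf \<mu> s"]
    by (simp add: algebra_simps)
  from has_sum_mono[OF lower upper this] show ?thesis by simp
qed

text \<open>
  Once the weight fails to decrease, it increases by at least 2 with every further letter. The
  reducedness of \<open>a # w\<close> ensures that at each vertex the edge back and the edge ahead are
  different, so that the midpoint inequality applies there.
\<close>

lemma weight_along_reduced_word:
  assumes "p \<in> carrier F" "a # w \<in> lists letters" "reduced_word (a # w)"
    and "weight F X \<mu> p \<le> weight F X \<mu> (p \<otimes> letter_val F a)"
  shows "weight F X \<mu> (p \<otimes> letter_val F a) + 2 * real (length w) \<le>
    weight F X \<mu> (p \<otimes> word_val F (a # w))"
  using assms
proof (induction w arbitrary: p a)
  case Nil
  then show ?case by simp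
next
  case (Cons b w)
  have a: "a \<in> letters" and b: "b \<in> letters" and w: "w \<in> lists letters"
    using Cons.prems by auto
  define q where "q = p \<otimes> letter_val F a"
  have q: "q \<in> carrier F" using a Cons.prems by (simp add: q_def)
  have "inv_letter a \<noteq> b" and red: "reduced_word (b # w)"
    using Cons.prems(3) by (auto simp: reduced_word_Cons[of a])
  \<comment> \<open>Both \<open>p\<close> and the next vertex are neighbours of \<open>q\<close>, in different directions.\<close>
  have "q \<otimes> letter_val F (inv_letter a) = p"
    using a Cons.prems by (simp add: q_def letter_val_inv_letter m_assoc)
  then have "2 * weight F X \<mu> q + 2 \<le> weight F X \<mu> p + weight F X \<mu> (q \<otimes> letter_val F b)"
    using weight_midpoint[OF q, of "inv_letter a" b] a b \<open>inv_letter a \<noteq> b\<close> by simp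
  then have step: "weight F X \<mu> q + 2 \<le> weight F X \<mu> (q \<otimes> letter_val F b)"
    using Cons.prems(4) by (simp add: q_def)
  have "weight F X \<mu> (q \<otimes> letter_val F b) + 2 * real (length w) \<le>
      weight F X \<mu> (q \<otimes> word_val F (b # w))"
    using q b w red step by (intro Cons.IH) auto
  moreover have "q \<otimes> word_val F (b # w) = p \<otimes> word_val F (a # b # w)"
    using a b w Cons.prems(1) by (simp add: q_def m_assoc)
  ultimately show ?case using step by (simp add: q_def)
qed

text \<open>
  The normal form of \<open>u\<inverse>v\<close> spells a path from \<open>u\<close> to \<open>v\<close> whose first step cannot decrease the
  weight, \<open>u\<close> being a minimum. A second step would put \<open>v\<close> strictly above \<open>u\<close>.
\<close>

lemma mean_set_adjacent:
  assumes u: "u \<in> mean_set F X \<mu>" and v: "v \<in> mean_set F X \<mu>" and "u \<noteq> v"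
  shows "\<exists>a\<in>letters. v = u \<otimes> letter_val F a"
proof -
  have c: "u \<in> carrier F" "v \<in> carrier F" using u v by (auto simp: mean_set_def)
  then have g: "inv u \<otimes> v \<in> carrier F" by simp
  have v_eq: "v = u \<otimes> word_val F (normal_form (inv u \<otimes> v))"
    using c normal_form(3)[OF g] by (simp add: m_assoc[symmetric])
  then obtain a w where nf: "normal_form (inv u \<otimes> v) = a # w"
    using c \<open>u \<noteq> v\<close> by (cases "normal_form (inv u \<otimes> v)") auto
  have a: "a \<in> letters" and w: "a # w \<in> lists letters" using normal_form(1)[OF g] by (auto simp: nf)
  have le: "weight F X \<mu> u \<le> weight F X \<mu> (u \<otimes> letter_val F a)"
    using u c a by (simp add: mean_set_def)
  have "weight F X \<mu> (u \<otimes> letter_val F a) + 2 * real (length w) \<le> weight F X \<mu> v"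
    using weight_along_reduced_word[OF c(1) w _ le] normal_form(2)[OF g] v_eq nf by simp
  moreover have "weight F X \<mu> v \<le> weight F X \<mu> u" using v c by (simp add: mean_set_def)
  ultimately have "real (length w) \<le> 0" using le by linarith
  then have "w = []" by simp
  then show ?thesis using v_eq nf a by auto
qed

text \<open>
  By adjacency \<open>v\<close> and \<open>t\<close> are both neighbours of \<open>u\<close>; were they different, the midpoint
  inequality at \<open>u\<close> would contradict their minimality.
\<close>

lemma mean_set_no_three:
  assumes "u \<in> mean_set F X \<mu>" "v \<in> mean_set F X \<mu>" "t \<in> mean_set F X \<mu>"
    and "u \<noteq> v" "u \<noteq> t"
  shows "v = t"
proof (rule ccontr)
  assume "v \<noteq> t"
  obtain a b where "a \<in> letters" "b \<in> letters"
    and v: "v = u \<otimes> letter_val F a" and t: "t = u \<otimes> letter_val F b"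
    using mean_set_adjacent assms by meson
  moreover have "a \<noteq> b" using v t \<open>v \<noteq> t\<close> by auto
  moreover have "u \<in> carrier F" using assms by (simp add: mean_set_def)
  ultimately have "2 * weight F X \<mu> u + 2 \<le> weight F X \<mu> v + weight F X \<mu> t"
    using weight_midpoint by simp
  moreover have "weight F X \<mu> v \<le> weight F X \<mu> u" "weight F X \<mu> t \<le> weight F X \<mu> u"
    using assms by (auto simp: mean_set_def)
  ultimately show False by simp
qed

end

section \<open>The size of the mean-set\<close>

theorem corollary5p9:
  fixes F :: "('a, 'm) monoid_scheme" and X :: "'a set" and \<mu> :: "'a pmf"
  assumes "group F"
    and "finite X"
    and "free_basis F X"
    and "set_pmf \<mu> \<subseteq> carrier F"
    and "weight_totally_defined F X \<mu>"
  shows "finite (mean_set F X \<mu>) \<and> card (mean_set F X \<mu>) \<le> 2"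
proof -
  interpret weighted_free_group F X \<mu>
    using assms by (intro weighted_free_group.intro free_group.intro
        free_group_axioms.intro weighted_free_group_axioms.intro)
  let ?E = "mean_set F X \<mu>"
  obtain u v where sub: "?E \<subseteq> {u, v}"
  proof (cases "\<exists>u\<in>?E. \<exists>v\<in>?E. u \<noteq> v")
    case True
    then obtain u v where "u \<in> ?E" "v \<in> ?E" "u \<noteq> v" by blast
    then have "?E \<subseteq> {u, v}" using mean_set_no_three by blast
    then show thesis by (rule that)
  next
    case False
    \<comment> \<open>The mean-set has at most one element; the second one of the pair is arbitrary.\<close>
    then have "?E \<subseteq> {SOME u. u \<in> ?E, undefined}"
      using someI[of "\<lambda>u. u \<in> ?E"] by blast
    then show thesis by (rule that)
  qed
  have "card ?E \<le> card {u, v}" using sub by (intro card_mono) auto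
  also have "\<dots> \<le> 2" by (simp add: card_insert_if)
  finally show ?thesis using sub finite_subset by auto
qed

end
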